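(* Let $R$ be a quasiorder on a non-empty set $U$. In the lattice $\mathcal{RS}$, for each $X\subseteq U$, the dual pseudocomplement of $\mathcal{A}(X)$ is $$\mathcal{A}(X)^+=\mathcal{A}(X^{\blacktriangledown\triangledown c}).$$
   Context: A quasiorder is a reflexive and transitive binary relation. For $x\in U$, $R(x)=\{y\in U\mid x\,R\,y\}$ and $R^{-1}(x)=\{y\in U\mid y\,R\,x\}$. For $X\subseteq U$, $X^{\blacktriangledown}=\{x\in U\mid R(x)\subseteq X\}$, $X^{\blacktriangle}=\{x\in U\mid R(x)\cap X\neq\emptyset\}$, $X^{\triangledown}=\{x\in U\mid R^{-1}(x)\subseteq X\}$, and $X^c=U\setminus X$. Stacked superscripts are applied from left to right, so $X^{\blacktriangledown\triangledown c}=((X^{\blacktriangledown})^{\triangledown})^c$. The rough set of $X$ is $\mathcal{A}(X)=(X^{\blacktriangledown},X^{\blacktriangle})$, $RS=\{\mathcal{A}(X)\mid X\subseteq U\}$, and $\mathcal{RS}=(RS,\leq)$ with $\leq$ the coordinatewise inclusion order on pairs of sets; for a quasiorder $R$ on a non-empty set this is a complete lattice with coordinatewise unions and intersections as joins and meets and with greatest element $(U,U)$. In a lattice with greatest element $1$, the dual pseudocomplement $x^+$ of $x$ is the (unique if it exists) element with $x\vee x^+=1$ such that, for all $y$, $x\vee y=1$ implies $x^+\leq y$. *)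

theory Defs
  imports "HOL-Algebra.Lattice"
begin

text \<open>A quasiorder on \<open>U\<close> is \<^term>\<open>preorder_on U R\<close>, which includes
  \<open>R \<subseteq> U \<times> U\<close>; the neighbourhoods \<open>R(x)\<close> and \<open>R\<inverse>(x)\<close> are the relational images
  \<open>R `` {x}\<close> and \<open>R\<inverse> `` {x}\<close>. The superscripts black down-triangle, black up-triangle
  and white down-triangle are \<open>lower_approx\<close>, \<open>upper_approx\<close> and \<open>inv_lower_approx\<close>.\<close>

definition lower_approx :: "'a set \<Rightarrow> 'a rel \<Rightarrow> 'a set \<Rightarrow> 'a set" where
  "lower_approx U R X = {x \<in> U. R `` {x} \<subseteq> X}"

definition upper_approx :: "'a set \<Rightarrow> 'a rel \<Rightarrow> 'a set \<Rightarrow> 'a set" where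
  "upper_approx U R X = {x \<in> U. R `` {x} \<inter> X \<noteq> {}}"

definition inv_lower_approx :: "'a set \<Rightarrow> 'a rel \<Rightarrow> 'a set \<Rightarrow> 'a set" where
  "inv_lower_approx U R X = {x \<in> U. R\<inverse> `` {x} \<subseteq> X}"

definition rough_set :: "'a set \<Rightarrow> 'a rel \<Rightarrow> 'a set \<Rightarrow> 'a set \<times> 'a set" where
  "rough_set U R X = (lower_approx U R X, upper_approx U R X)"

definition RS :: "'a set \<Rightarrow> 'a rel \<Rightarrow> ('a set \<times> 'a set) gorder" where
  "RS U R = \<lparr>carrier = {rough_set U R X | X. X \<subseteq> U}, eq = (=),
     le = (\<lambda>p q. fst p \<subseteq> fst q \<and> snd p \<subseteq> snd q)\<rparr>"

text \<open>Meant for lattices with a greatest element: elsewhere the joins and \<open>\<top>\<close>, being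
  Hilbert choices in the library, may be unspecified.\<close>

definition is_dual_pseudocomplement :: "('a, 'b) gorder_scheme \<Rightarrow> 'a \<Rightarrow> 'a \<Rightarrow> bool" where
  "is_dual_pseudocomplement L x z \<longleftrightarrow>
     z \<in> carrier L \<and> x \<squnion>\<^bsub>L\<^esub> z = \<top>\<^bsub>L\<^esub> \<and>
     (\<forall>y \<in> carrier L. x \<squnion>\<^bsub>L\<^esub> y = \<top>\<^bsub>L\<^esub> \<longrightarrow> z \<sqsubseteq>\<^bsub>L\<^esub> y)"

definition dual_pseudocomplement :: "('a, 'b) gorder_scheme \<Rightarrow> 'a \<Rightarrow> 'a" where
  "dual_pseudocomplement L x = (THE z. is_dual_pseudocomplement L x z)"

end

theory Submission
  imports Defs
begin

text \<open>
  The inequation defining the dual pseudocomplement is easy to solve once joins in the lattice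
  of rough sets are known to be coordinatewise unions: since a lower approximation is contained
  in the upper one, \<open>\<A>(X) \<squnion> \<A>(Y) = (U, U)\<close> then says just that the lower approximations of
  \<open>X\<close> and \<open>Y\<close> cover \<open>U\<close>. So \<open>Y\<^sup>\<down>\<close>, the lower approximation of \<open>Y\<close>, has to contain every point
  outside \<open>X\<^sup>\<down>\<close>; being closed under \<open>R\<close>-successors, it then contains every \<open>R\<close>-successor of such
  a point. The set of these successors is exactly the complement of
  \<open>inv_lower_approx U R (lower_approx U R X)\<close>, and it is itself a successor-closed set \<open>Z\<close>, hence
  equal to its lower approximation. The condition on \<open>Y\<close> is therefore \<open>Z \<subseteq> Y\<^sup>\<down>\<close>
  (\<open>lower_approx_cover_iff\<close>), which amounts to \<open>\<A>(Z) \<le> \<A>(Y)\<close>.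

  The substance is that the coordinatewise union of two rough sets is again a rough set
  (\<open>rough_set_union\<close>). The union \<open>X \<union> Y\<close> has the right upper approximation but its lower
  approximation may be too large, so elements must be dropped from it without losing any
  of the upper approximation. An explicit choice of what to drop makes this work for all
  quasiorders, including those in which \<open>U\<close> has no maximal elements.
\<close>

section \<open>Approximations with respect to a quasiorder\<close>

lemma lower_approx_mono: "X \<subseteq> Y \<Longrightarrow> lower_approx U R X \<subseteq> lower_approx U R Y"
  unfolding lower_approx_def by blast

lemma upper_approx_mono: "X \<subseteq> Y \<Longrightarrow> upper_approx U R X \<subseteq> upper_approx U R Y"
  unfolding upper_approx_def by blast

lemma preorder_on_reflD: "preorder_on U R \<Longrightarrow> x \<in> U \<Longrightarrow> (x, x) \<in> R"
  unfolding preorder_on_def refl_on_def by blast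

lemma preorder_on_transD: "preorder_on U R \<Longrightarrow> (x, y) \<in> R \<Longrightarrow> (y, z) \<in> R \<Longrightarrow> (x, z) \<in> R"
  unfolding preorder_on_def trans_def by blast

lemma preorder_on_fieldD:
  assumes "preorder_on U R" "(x, y) \<in> R"
  shows "x \<in> U" "y \<in> U"
  using assms unfolding preorder_on_def refl_on_def by blast+

lemma lower_approx_subset:
  assumes "preorder_on U R"
  shows "lower_approx U R X \<subseteq> X"
  using preorder_on_reflD[OF assms] unfolding lower_approx_def by blast

lemma lower_approx_closed:
  assumes "preorder_on U R" "x \<in> lower_approx U R X" "(x, y) \<in> R"
  shows "y \<in> lower_approx U R X"
  using assms(2,3) preorder_on_transD[OF assms(1)] preorder_on_fieldD[OF assms(1)]
  unfolding lower_approx_def by blast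

lemma lower_approx_subset_upper_approx:
  assumes "preorder_on U R"
  shows "lower_approx U R X \<subseteq> upper_approx U R X"
  using preorder_on_reflD[OF assms] unfolding lower_approx_def upper_approx_def by blast

section \<open>Joins of rough sets\<close>

text \<open>Write \<open>A\<close> for the union of the two lower approximations; \<open>A\<close> has to be kept. A point that
  sees \<open>A\<close> lies in the upper approximation already because of \<open>A\<close>, so outside \<open>A\<close> it may be
  dropped, which also keeps it out of the new lower approximation. A point \<open>x\<close> that does not see
  \<open>A\<close> sees only points of the same kind. Among those, \<open>X\<close> is kept, and \<open>Y\<close> only where \<open>X\<close> is not
  seen. If such an \<open>x\<close> were in the new lower approximation, then, not being in that of \<open>X\<close>, it
  would see some \<open>w \<notin> X\<close>, where \<open>w \<in> Y\<close> sees nothing of \<open>X\<close>. All that \<open>w\<close> sees would then be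
  in \<open>Y\<close>, that is, \<open>w \<in> A\<close>: a contradiction.\<close>

lemma rough_set_union:
  assumes R: "preorder_on U R" and XY: "X \<subseteq> U" "Y \<subseteq> U"
  obtains Z where "Z \<subseteq> U"
    and "lower_approx U R Z = lower_approx U R X \<union> lower_approx U R Y"
    and "upper_approx U R Z = upper_approx U R X \<union> upper_approx U R Y"
proof -
  note refl = preorder_on_reflD[OF R]
  note trans = preorder_on_transD[OF R]
  note field = preorder_on_fieldD[OF R]
  define A where "A = lower_approx U R X \<union> lower_approx U R Y"
  define Z where
    "Z = A \<union> (X - upper_approx U R A) \<union> (Y - (upper_approx U R X \<union> upper_approx U R A))"
  have A_XY: "A \<subseteq> X \<union> Y"
    using lower_approx_subset[OF R] unfolding A_def by blast
  have A_closed: "y \<in> A" if "x \<in> A" "(x, y) \<in> R" for x y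
    using that lower_approx_closed[OF R] unfolding A_def by blast
  have seen: "x \<in> upper_approx U R V" if "(x, y) \<in> R" "y \<in> upper_approx U R V" for x y V
    using that trans field unfolding upper_approx_def by blast
  have Z_XY: "Z \<subseteq> X \<union> Y"
    using A_XY unfolding Z_def by blast
  have "lower_approx U R Z \<subseteq> A"
  proof (rule subsetI, rule ccontr)
    fix x assume xZ: "x \<in> lower_approx U R Z" and xA: "x \<notin> A"
    have xU: "x \<in> U" using xZ unfolding lower_approx_def by blast
    have inZ: "y \<in> Z" if "(x, y) \<in> R" for y
      using xZ that unfolding lower_approx_def by blast
    have notA: "x \<notin> upper_approx U R A"
      using inZ[OF refl[OF xU]] xA unfolding Z_def by blast
    have "x \<notin> lower_approx U R X" using xA unfolding A_def by blast
    then obtain w where w: "(x, w) \<in> R" "w \<notin> X"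
      using xU unfolding lower_approx_def by blast
    have wA: "w \<notin> A" using w notA xU unfolding upper_approx_def by blast
    have wX: "w \<notin> upper_approx U R X"
      using inZ[OF w(1)] w wA unfolding Z_def by blast
    have "y \<in> Y" if "(w, y) \<in> R" for y
      using inZ[OF trans[OF w(1) that]] wX that field(1)[OF that] Z_XY
      unfolding upper_approx_def by blast
    then have "w \<in> A"
      using field(2)[OF w(1)] unfolding A_def lower_approx_def by blast
    with wA show False ..
  qed
  moreover have "A \<subseteq> lower_approx U R Z"
  proof
    fix x assume "x \<in> A"
    moreover from this have "x \<in> U" unfolding A_def lower_approx_def by blast
    ultimately show "x \<in> lower_approx U R Z"
      using A_closed unfolding lower_approx_def Z_def by blast
  qed
  moreover have "upper_approx U R Z \<subseteq> upper_approx U R X \<union> upper_approx U R Y"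
    using Z_XY unfolding upper_approx_def by blast
  moreover have "x \<in> upper_approx U R Z"
    if x: "x \<in> upper_approx U R X \<union> upper_approx U R Y" for x
  proof -
    have xU: "x \<in> U" using x unfolding upper_approx_def by blast
    consider "x \<in> upper_approx U R A"
      | "x \<notin> upper_approx U R A" "x \<in> upper_approx U R X"
      | "x \<notin> upper_approx U R A" "x \<notin> upper_approx U R X" "x \<in> upper_approx U R Y"
      using x by blast
    then show ?thesis
    proof cases
      case 1
      then show ?thesis using upper_approx_mono[of A Z U R] unfolding Z_def by blast
    next
      case 2
      then obtain y where "(x, y) \<in> R" "y \<in> X" unfolding upper_approx_def by blast
      moreover from this have "y \<in> Z" using 2 seen unfolding Z_def by blast
      ultimately show ?thesis using xU unfolding upper_approx_def by blast
    next
      case 3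
      then obtain y where "(x, y) \<in> R" "y \<in> Y" unfolding upper_approx_def by blast
      moreover from this have "y \<in> Z" using 3 seen unfolding Z_def by blast
      ultimately show ?thesis using xU unfolding upper_approx_def by blast
    qed
  qed
  ultimately show thesis
    using that[of Z] Z_XY XY unfolding A_def by blast
qed

lemma partial_order_RS: "partial_order (RS U R)"
  by unfold_locales (auto simp: RS_def prod_eq_iff)

lemma rough_set_in_RS: "X \<subseteq> U \<Longrightarrow> rough_set U R X \<in> carrier (RS U R)"
  by (auto simp: RS_def)

lemma le_RS_iff: "p \<sqsubseteq>\<^bsub>RS U R\<^esub> q \<longleftrightarrow> fst p \<subseteq> fst q \<and> snd p \<subseteq> snd q"
  by (simp add: RS_def)

text \<open>The join is a Hilbert choice among least upper bounds. Its value is therefore known only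
  because the coordinatewise union, being a rough set, is one, and antisymmetry leaves no
  other.\<close>

lemma join_RS:
  assumes R: "preorder_on U R" and XY: "X \<subseteq> U" "Y \<subseteq> U"
  shows "rough_set U R X \<squnion>\<^bsub>RS U R\<^esub> rough_set U R Y =
    (lower_approx U R X \<union> lower_approx U R Y, upper_approx U R X \<union> upper_approx U R Y)"
proof -
  interpret partial_order "RS U R" by (rule partial_order_RS)
  obtain Z where Z: "Z \<subseteq> U"
    "lower_approx U R Z = lower_approx U R X \<union> lower_approx U R Y"
    "upper_approx U R Z = upper_approx U R X \<union> upper_approx U R Y"
    using rough_set_union[OF assms] .
  have "least (RS U R) (rough_set U R Z)
      (Upper (RS U R) {rough_set U R X, rough_set U R Y})"
    using Z XY rough_set_in_RS[of X U R] rough_set_in_RS[of Y U R] rough_set_in_RS[of Z U R]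
    by (auto simp: least_def Upper_def le_RS_iff rough_set_def)
  then have "rough_set U R X \<squnion>\<^bsub>RS U R\<^esub> rough_set U R Y = rough_set U R Z"
    unfolding join_def sup_def by (blast intro: some_equality least_unique)
  then show ?thesis by (simp add: rough_set_def Z)
qed

lemma top_RS:
  assumes R: "preorder_on U R"
  shows "\<top>\<^bsub>RS U R\<^esub> = (U, U)"
proof -
  interpret partial_order "RS U R" by (rule partial_order_RS)
  have U: "rough_set U R U = (U, U)"
    using preorder_on_reflD[OF R] preorder_on_fieldD[OF R]
    unfolding rough_set_def lower_approx_def upper_approx_def by blast
  have "greatest (RS U R) (U, U) (carrier (RS U R))"
    using rough_set_in_RS[of U U R] unfolding U greatest_def
    by (auto simp: RS_def rough_set_def lower_approx_def upper_approx_def)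
  then show ?thesis
    unfolding top_def by (blast intro: some_equality greatest_unique)
qed

text \<open>No condition on the upper approximations remains because they contain the lower ones.\<close>

lemma join_RS_eq_top_iff:
  assumes R: "preorder_on U R" and XY: "X \<subseteq> U" "Y \<subseteq> U"
  shows "rough_set U R X \<squnion>\<^bsub>RS U R\<^esub> rough_set U R Y = \<top>\<^bsub>RS U R\<^esub> \<longleftrightarrow>
    lower_approx U R X \<union> lower_approx U R Y = U"
proof -
  have "upper_approx U R X \<union> upper_approx U R Y \<subseteq> U"
    unfolding upper_approx_def by blast
  then show ?thesis
    using lower_approx_subset_upper_approx[OF R, of X]
      lower_approx_subset_upper_approx[OF R, of Y]
    unfolding join_RS[OF assms] top_RS[OF R] by auto
qed

section \<open>Dual pseudocomplements\<close>

text \<open>The set on the left of the inclusion consists of the \<open>R\<close>-successors of points outside the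
  lower approximation of \<open>X\<close>. By reflexivity those points themselves belong to it, so the inclusion
  forces a cover; conversely, in a cover those points lie in the lower approximation of \<open>Y\<close>, and
  so do their successors because it is successor-closed.\<close>

lemma lower_approx_cover_iff:
  assumes R: "preorder_on U R"
  shows "lower_approx U R X \<union> lower_approx U R Y = U \<longleftrightarrow>
    U - inv_lower_approx U R (lower_approx U R X) \<subseteq> lower_approx U R Y" (is "?L \<longleftrightarrow> ?R")
proof
  assume L: ?L
  show ?R
  proof
    fix w assume "w \<in> U - inv_lower_approx U R (lower_approx U R X)"
    then obtain y where y: "(y, w) \<in> R" "y \<notin> lower_approx U R X"
      unfolding inv_lower_approx_def by blast
    have "y \<in> U" using preorder_on_fieldD(1)[OF R y(1)] .
    then have "y \<in> lower_approx U R Y" using L y(2) by blast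
    then show "w \<in> lower_approx U R Y" using lower_approx_closed[OF R] y(1) by blast
  qed
next
  assume ?R
  then show ?L
    using preorder_on_reflD[OF R] unfolding inv_lower_approx_def lower_approx_def by blast
qed

lemma lower_approx_successors_outside:
  fixes X :: "'a set"
  assumes R: "preorder_on U R"
  defines "Z \<equiv> U - inv_lower_approx U R (lower_approx U R X)"
  shows "lower_approx U R Z = Z"
proof
  show "lower_approx U R Z \<subseteq> Z" by (rule lower_approx_subset[OF R])
  show "Z \<subseteq> lower_approx U R Z"
  proof
    fix w assume "w \<in> Z"
    then obtain y where w: "w \<in> U" and y: "(y, w) \<in> R" "y \<notin> lower_approx U R X"
      unfolding Z_def inv_lower_approx_def by blast
    have "v \<in> Z" if "(w, v) \<in> R" for v
    proof -
      have "(y, v) \<in> R" "v \<in> U"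
        using preorder_on_transD[OF R y(1) that] preorder_on_fieldD(2)[OF R that] .
      then show ?thesis using y(2) unfolding Z_def inv_lower_approx_def by blast
    qed
    then show "w \<in> lower_approx U R Z" using w unfolding lower_approx_def by blast
  qed
qed

lemma is_dual_pseudocomplement_unique:
  assumes "partial_order L" "is_dual_pseudocomplement L x z" "is_dual_pseudocomplement L x z'"
  shows "z = z'"
proof -
  interpret partial_order L by fact
  show ?thesis using assms(2,3) unfolding is_dual_pseudocomplement_def
    by (blast intro: le_antisym)
qed

theorem proposition4p3:
  fixes U :: "'a set" and R :: "'a rel" and X :: "'a set"
  assumes "preorder_on U R" and "U \<noteq> {}" and "X \<subseteq> U"
  shows "is_dual_pseudocomplement (RS U R) (rough_set U R X)
           (rough_set U R (U - inv_lower_approx U R (lower_approx U R X)))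
       \<and> dual_pseudocomplement (RS U R) (rough_set U R X)
           = rough_set U R (U - inv_lower_approx U R (lower_approx U R X))"
proof -
  define Z where "Z = U - inv_lower_approx U R (lower_approx U R X)"
  note R = assms(1)
  have ZU: "Z \<subseteq> U" unfolding Z_def by blast
  have cover_iff: "rough_set U R X \<squnion>\<^bsub>RS U R\<^esub> rough_set U R Y = \<top>\<^bsub>RS U R\<^esub> \<longleftrightarrow>
      Z \<subseteq> lower_approx U R Y" if "Y \<subseteq> U" for Y
    using join_RS_eq_top_iff[OF R assms(3) that] lower_approx_cover_iff[OF R]
    unfolding Z_def by metis
  have least: "rough_set U R Z \<sqsubseteq>\<^bsub>RS U R\<^esub> rough_set U R Y" if "Z \<subseteq> lower_approx U R Y" for Y
  proof -
    have "Z \<subseteq> Y" using that lower_approx_subset[OF R] by blast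
    then show ?thesis
      by (simp add: le_RS_iff rough_set_def lower_approx_mono upper_approx_mono)
  qed
  have dpc: "is_dual_pseudocomplement (RS U R) (rough_set U R X) (rough_set U R Z)"
    unfolding is_dual_pseudocomplement_def
  proof (intro conjI ballI impI)
    show "rough_set U R Z \<in> carrier (RS U R)" using ZU by (rule rough_set_in_RS)
    show "rough_set U R X \<squnion>\<^bsub>RS U R\<^esub> rough_set U R Z = \<top>\<^bsub>RS U R\<^esub>"
      using cover_iff[OF ZU] lower_approx_successors_outside[OF R] unfolding Z_def by blast
  next
    fix y assume y: "y \<in> carrier (RS U R)" and top: "rough_set U R X \<squnion>\<^bsub>RS U R\<^esub> y = \<top>\<^bsub>RS U R\<^esub>"
    from y obtain Y where "Y \<subseteq> U" "y = rough_set U R Y" by (auto simp: RS_def)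
    then show "rough_set U R Z \<sqsubseteq>\<^bsub>RS U R\<^esub> y"
      using top cover_iff least by blast
  qed
  moreover have "dual_pseudocomplement (RS U R) (rough_set U R X) = rough_set U R Z"
    unfolding dual_pseudocomplement_def
    using dpc is_dual_pseudocomplement_unique[OF partial_order_RS] by blast
  ultimately show ?thesis unfolding Z_def by blast
qed

end
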